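(* Let $\Pi$ be a probability measure on $\mathbb{R}^d$ with density $\pi\propto\exp(-U)$, $U\in C^2(\mathbb{R}^d)$, with covariance $\Sigma_\pi$, mode $x^*\in\mathbb{R}^d$ and expectation $\mu_\pi\in\mathbb{R}^d$. Suppose $\nabla^2U(x)=A+B(x)$ for all $x\in\mathbb{R}^d$, where $A,B(x)\in\mathbb{R}^{d\times d}$ are symmetric, and that for some $\epsilon>0$ we have $\|B(x)\|\le\epsilon$ for all $x$ and $\epsilon\mathbf{I}_d\prec A$. If $1-(x^*-\mu_\pi)^T(A+\epsilon\mathbf{I}_d)(x^*-\mu_\pi)>0$, then for all $x\in\mathbb{R}^d$ \[ \|\nabla^2U(x)-\Sigma_\pi^{-1}\|\le(c^{-1}+1)\epsilon+(c^{-1}-1)\|A\|+\max\{\|\tilde P_-\|,\|\tilde P_+\|\}, \] where \[ \tilde P_+=c^{-1}\bigl(1-\mathrm{Tr}(\tilde D_+)\bigr)^{-1}\tilde D_+(A+\epsilon\mathbf{I}_d),\qquad \tilde P_-=c\,\bigl(1-\mathrm{Tr}(\tilde D_-)\bigr)^{-1}\tilde D_-(A-\epsilon\mathbf{I}_d), \] \[ \tilde D_\pm=(A\pm\epsilon\mathbf{I}_d)(x^*-\mu_\pi)(x^*-\mu_\pi)^T,\qquad c=\sqrt{\det(A-\epsilon\mathbf{I}_d)\det(A+\epsilon\mathbf{I}_d)^{-1}}\le1 . \]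
   Context: $\prec$ denotes the strict Loewner order on symmetric matrices and $\|\cdot\|$ the operator 2-norm. The mode $x^*$ is the maximiser of $\pi$, i.e. the minimiser of $U$. *)

theory Defs
  imports "HOL-Probability.Probability"
begin

definition grad :: "(real^'n \<Rightarrow> real) \<Rightarrow> real^'n \<Rightarrow> real^'n" where
  "grad f x = (\<chi> i. frechet_derivative f (at x) (axis i 1))"

definition hessian :: "(real^'n \<Rightarrow> real) \<Rightarrow> real^'n \<Rightarrow> real^'n^'n" where
  "hessian f x = jacobian (grad f) (at x)"

(* frechet_derivative is an arbitrary choice where no derivative exists, so both
   orders of differentiability have to be demanded explicitly. *)
definition C2 :: "(real^'n \<Rightarrow> real) \<Rightarrow> bool" where
  "C2 f \<longleftrightarrow> (\<forall>x. f differentiable (at x)) \<and> (\<forall>x. grad f differentiable (at x)) \<and>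
     continuous_on UNIV (hessian f)"

definition symmetric_mat :: "real^'n^'n \<Rightarrow> bool" where
  "symmetric_mat M \<longleftrightarrow> transpose M = M"

definition loewner_less :: "real^'n^'n \<Rightarrow> real^'n^'n \<Rightarrow> bool" (infix "\<prec>\<^sub>L" 50) where
  "M \<prec>\<^sub>L N \<longleftrightarrow> symmetric_mat M \<and> symmetric_mat N \<and>
     (\<forall>x. x \<noteq> 0 \<longrightarrow> x \<bullet> (M *v x) < x \<bullet> (N *v x))"

(* norm on real^'n^'n is the Frobenius norm, hence onorm. *)
abbreviation op_norm :: "real^'n^'n \<Rightarrow> real" where
  "op_norm M \<equiv> onorm ((*v) M)"

definition outer :: "real^'n \<Rightarrow> real^'n \<Rightarrow> real^'n^'n" where
  "outer v w = (\<chi> i j. v $ i * w $ j)"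

definition mean_vec :: "(real^'n) measure \<Rightarrow> real^'n" where
  "mean_vec M = (LINT x|M. x)"

definition covariance_mat :: "(real^'n) measure \<Rightarrow> real^'n^'n" where
  "covariance_mat M =
     (\<chi> i j. LINT x|M. (x $ i - mean_vec M $ i) * (x $ j - mean_vec M $ j))"

end

theory Submission
  imports Defs
begin

text \<open>
  Write \<open>P = A + \<epsilon>I\<close> and \<open>Q = A - \<epsilon>I\<close>. Taylor expansion at the mode \<open>x\<^sup>*\<close> squeezes the density
  between \<open>K exp(-(x-x\<^sup>*)\<^sup>TP(x-x\<^sup>*)/2)\<close> and \<open>K exp(-(x-x\<^sup>*)\<^sup>TQ(x-x\<^sup>*)/2)\<close>, whose total masses have
  ratio \<open>c\<close>. The second moment in direction \<open>v\<close> about \<open>x\<^sup>*\<close> is therefore at most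
  \<open>c\<^sup>-\<^sup>1 v\<^sup>TQ\<^sup>-\<^sup>1v\<close>, and about the mean, since the lower Gaussian is symmetric about \<open>x\<^sup>*\<close>, at least
  \<open>c v\<^sup>TP\<^sup>-\<^sup>1v\<close>. As the variance is the smallest second moment, \<open>cP\<^sup>-\<^sup>1 \<le> \<Sigma> \<le> c\<^sup>-\<^sup>1Q\<^sup>-\<^sup>1\<close>, i.e.
  \<open>cQ \<le> \<Sigma>\<^sup>-\<^sup>1 \<le> c\<^sup>-\<^sup>1P\<close>. Together with \<open>Q \<le> \<nabla>\<^sup>2U \<le> P\<close> this already yields the bound without its
  last summand.
\<close>

section \<open>Quadratic forms and the Loewner order\<close>

lemma symmetric_mat_inner:
  fixes M :: "real^'n^'n"
  assumes "symmetric_mat M"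
  shows "x \<bullet> (M *v y) = (M *v x) \<bullet> y"
  using assms dot_lmul_matrix[of x M y] vector_transpose_matrix[of x M]
  by (simp add: symmetric_mat_def)

lemma symmetric_mat_iff_inner:
  fixes M :: "real^'n^'n"
  shows "symmetric_mat M \<longleftrightarrow> (\<forall>x y. x \<bullet> (M *v y) = (M *v x) \<bullet> y)"
proof
  assume *: "\<forall>x y. x \<bullet> (M *v y) = (M *v x) \<bullet> y"
  have "M $ i $ j = M $ j $ i" for i j
    using *[rule_format, of "axis i 1" "axis j 1"]
    by (simp add: matrix_vector_mul_component inner_axis inner_axis' inner_commute)
  then show "symmetric_mat M"
    by (simp add: symmetric_mat_def vec_eq_iff transpose_def)
qed (auto simp: symmetric_mat_inner)

lemma zero_loewner_less_iff:
  fixes M :: "real^'n^'n"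
  shows "0 \<prec>\<^sub>L M \<longleftrightarrow> symmetric_mat M \<and> (\<forall>x. x \<noteq> 0 \<longrightarrow> 0 < x \<bullet> (M *v x))"
  by (auto simp: loewner_less_def symmetric_mat_def transpose_def vec_eq_iff)

lemma zero_loewner_less_imp_invertible:
  fixes M :: "real^'n^'n"
  assumes "0 \<prec>\<^sub>L M"
  shows "invertible M"
proof -
  have "x = 0" if "M *v x = 0" for x
    using assms that by (metis inner_zero_right less_irrefl zero_loewner_less_iff)
  then show ?thesis
    by (metis invertible_left_inverse matrix_left_invertible_ker)
qed

section \<open>Inverses of square matrices\<close>

lemma matrix_inv_mult:
  fixes M :: "'a::semiring_1^'n^'m"
  assumes "invertible M"
  shows "M ** matrix_inv M = mat 1" "matrix_inv M ** M = mat 1"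
proof -
  have "\<exists>M'. M ** M' = mat 1 \<and> M' ** M = mat 1"
    using assms by (simp add: invertible_def)
  from someI_ex[OF this] show "M ** matrix_inv M = mat 1" "matrix_inv M ** M = mat 1"
    by (simp_all add: matrix_inv_def)
qed

lemma matrix_inv_mult_vec:
  fixes M :: "real^'n^'n"
  assumes "invertible M"
  shows "M *v (matrix_inv M *v x) = x" "matrix_inv M *v (M *v x) = x"
  by (simp_all add: matrix_vector_mul_assoc matrix_inv_mult[OF assms])

lemma matrix_inv_eqI:
  fixes M N :: "real^'n^'n"
  assumes "M ** N = mat 1"
  shows "matrix_inv M = N"
proof -
  have "invertible M"
    using assms invertible_right_inverse by blast
  then show ?thesis
    by (metis assms matrix_inv_mult(2) matrix_mul_assoc matrix_mul_lid matrix_mul_rid)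
qed

text \<open>Gram--Schmidt with respect to the inner product induced by \<open>M\<close>.\<close>

lemma loewner_pos_congruent_mat_1:
  fixes M :: "real^'n^'n"
  assumes "0 \<prec>\<^sub>L M"
  obtains S :: "real^'n^'n" where "transpose S ** M ** S = mat 1"
proof -
  have sym: "x \<bullet> (M *v y) = (M *v x) \<bullet> y" for x y
    using assms symmetric_mat_inner zero_loewner_less_iff by blast
  have pos: "0 < x \<bullet> (M *v x)" if "x \<noteq> 0" for x
    using assms that zero_loewner_less_iff by blast
  have "\<exists>b. \<forall>i\<in>I. \<forall>j\<in>I. b i \<bullet> (M *v b j) = of_bool (i = j)" for I :: "'n set"
  proof (induction I rule: finite_induct[OF finite])
    case (2 k I)
    then obtain b where b: "\<And>i j. i \<in> I \<Longrightarrow> j \<in> I \<Longrightarrow> b i \<bullet> (M *v b j) = of_bool (i = j)"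
      by blast
    \<comment> \<open>Being \<open>M\<close>-orthogonal to every \<open>b i\<close> means being
      orthogonal to these vectors. There are too few of them to span the whole space, because
      \<open>k\<close> is not in \<open>I\<close>.\<close>
    let ?V = "(\<lambda>i. M *v b i) ` I"
    have "dim ?V \<le> card I"
      by (meson card_image_le dim_le_card' finite finite_imageI le_trans)
    also have "card I < DIM(real^'n)"
      using 2 psubset_card_mono[of UNIV I] by auto
    finally have "dim ?V < DIM(real^'n)" .
    then obtain x where x: "x \<noteq> 0" "\<And>y. y \<in> span ?V \<Longrightarrow> orthogonal x y"
      using orthogonal_to_subspace_exists by blast
    have xb: "x \<bullet> (M *v b i) = 0" if "i \<in> I" for i
      using x(2) that by (simp add: orthogonal_def span_base)
    define r where "r = sqrt (x \<bullet> (M *v x))"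
    have r: "r > 0" "r * r = x \<bullet> (M *v x)"
      using pos[OF x(1)] by (simp_all add: r_def)
    \<comment> \<open>The new vector is scaled to unit length in the norm induced by
      \<open>M\<close>.\<close>
    define b' where "b' = b(k := x /\<^sub>R r)"
    have bx: "b i \<bullet> (M *v x) = 0" if "i \<in> I" for i
      using xb[OF that] by (metis inner_commute sym)
    have "b' i \<bullet> (M *v b' j) = of_bool (i = j)" if "i \<in> insert k I" "j \<in> insert k I" for i j
    proof (cases "i = k"; cases "j = k")
      assume "i = k" "j = k"
      moreover have "inverse r * (inverse r * (r * r)) = 1"
        using r(1) by (simp add: field_simps)
      ultimately show ?thesis
        using r(2) by (simp add: b'_def matrix_vector_mult_scaleR)
    qed (use that 2 in \<open>auto simp: b'_def b xb bx matrix_vector_mult_scaleR\<close>)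
    then show ?case by blast
  qed simp
  from this[of UNIV] obtain b :: "'n \<Rightarrow> real^'n"
    where b: "b i \<bullet> (M *v b j) = of_bool (i = j)" for i j
    by auto
  \<comment> \<open>With the \<open>b j\<close> as columns, \<open>transpose S ** M ** S\<close> is
    their Gram matrix for the form of \<open>M\<close>.\<close>
  define S :: "real^'n^'n" where "S = (\<chi> i j. b j $ i)"
  have S_axis: "S *v axis j 1 = b j" for j
    by (simp add: S_def matrix_vector_mult_basis column_def)
  have "transpose S ** M ** S = mat 1"
  proof -
    have "(transpose S ** M ** S) $ i $ j = mat 1 $ i $ j" for i j
    proof -
      have "(transpose S ** M ** S) $ i $ j = axis i 1 \<bullet> ((transpose S ** M ** S) *v axis j 1)"
        by (simp add: inner_axis' matrix_vector_mult_basis column_def)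
      also have "\<dots> = (S *v axis i 1) \<bullet> (M *v (S *v axis j 1))"
        by (metis dot_lmul_matrix matrix_vector_mul_assoc transpose_transpose vector_transpose_matrix)
      finally show ?thesis
        by (simp add: S_axis b mat_def)
    qed
    then show ?thesis by (simp add: vec_eq_iff)
  qed
  then show thesis by (rule that)
qed

text \<open>These are the data for the substitution \<open>x = S *v y\<close> in a Gaussian
  integral: the exponent becomes standard, the Jacobian is explicit, and
  \<open>S ** transpose S\<close> is the inverse of \<open>M\<close>.\<close>

lemma congruent_mat_1:
  fixes M S :: "real^'n^'n"
  assumes S: "transpose S ** M ** S = mat 1"
  shows "(S *v x) \<bullet> (M *v (S *v x)) = x \<bullet> x" "M ** (S ** transpose S) = mat 1"
    "det M > 0" "\<bar>det S\<bar> = 1 / sqrt (det M)"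
proof -
  show "(S *v x) \<bullet> (M *v (S *v x)) = x \<bullet> x"
    by (metis S dot_lmul_matrix matrix_vector_mul_assoc matrix_vector_mul_lid
        transpose_transpose vector_transpose_matrix)
  \<comment> \<open>A one-sided inverse of a square matrix is two-sided. This is used twice to move
    \<open>M\<close> to the front.\<close>
  have "S ** (transpose S ** M) = mat 1"
    using S matrix_left_right_inverse by blast
  then show "M ** (S ** transpose S) = mat 1"
    using matrix_left_right_inverse matrix_mul_assoc by metis
  have d: "det S * det M * det S = 1"
    using arg_cong[OF S, of det] by (simp add: det_mul)
  then have "(det S)\<^sup>2 * det M = 1"
    by (simp add: power2_eq_square ac_simps)
  then show "det M > 0"
    by (metis zero_le_power2 zero_less_mult_pos zero_less_one power_zero_numeral mult_zero_left order_le_less)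
  have "(det S)\<^sup>2 = 1 / det M"
    using \<open>(det S)\<^sup>2 * det M = 1\<close> \<open>det M > 0\<close> by (simp add: field_simps)
  then show "\<bar>det S\<bar> = 1 / sqrt (det M)"
    by (metis real_sqrt_abs real_sqrt_divide real_sqrt_one)
qed

text \<open>Loewner-monotonicity of inversion, tested on a single vector \<open>u = P a = Q b\<close>.\<close>

lemma quadratic_form_inverse_antimono:
  fixes P Q :: "real^'n^'n"
  assumes "symmetric_mat P" and "\<And>v. 0 \<le> v \<bullet> (P *v v)"
    and le: "\<And>v. v \<bullet> (P *v v) \<le> v \<bullet> (Q *v v)"
    and "P *v a = u" "Q *v b = u"
  shows "b \<bullet> u \<le> a \<bullet> u"
proof -
  \<comment> \<open>Completing the square: expanding the form of \<open>P\<close> at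
    \<open>a - b\<close> leaves only \<open>b \<bullet> (P *v b)\<close> to be estimated, and that
    is at most \<open>b \<bullet> (Q *v b) = b \<bullet> u\<close>.\<close>
  have "0 \<le> (a - b) \<bullet> (P *v (a - b))"
    by (rule assms)
  also have "\<dots> = a \<bullet> u - 2 * (b \<bullet> u) + b \<bullet> (P *v b)"
    using assms(4) symmetric_mat_inner[OF assms(1), of a b]
    by (simp add: matrix_vector_mult_diff_distrib algebra_simps inner_commute)
  also have "\<dots> \<le> a \<bullet> u - b \<bullet> u"
    using le[of b] assms(5) by simp
  finally show ?thesis by simp
qed

section \<open>Operator norm and quadratic form\<close>

text \<open>Polarisation recovers \<open>y \<bullet> (M *v x)\<close> from the form at
  \<open>x + y\<close> and \<open>x - y\<close>, and the parallelogram law adds up the two bounds.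
  This turns Loewner bounds into norm bounds.\<close>

lemma symmetric_mat_op_norm_le:
  fixes M :: "real^'n^'n"
  assumes "symmetric_mat M" and le: "\<And>x. \<bar>x \<bullet> (M *v x)\<bar> \<le> K * (x \<bullet> x)"
  shows "op_norm M \<le> K"
proof (rule onorm_bound)
  \<comment> \<open>Index types are nonempty, so a unit vector is available to test the sign of
    \<open>K\<close>.\<close>
  obtain k :: 'n where True by simp
  show "0 \<le> K"
    using le[of "axis k 1"] by (simp add: inner_axis_axis)
  fix x
  show "norm (M *v x) \<le> K * norm x"
  proof (cases "x = 0 \<or> M *v x = 0")
    case True
    then show ?thesis using \<open>0 \<le> K\<close> by auto
  next
    case False
    \<comment> \<open>The vector \<open>M *v x\<close> rescaled to the length of \<open>x\<close>:
      Cauchy-Schwarz is then an equality, and the parallelogram law gives exactly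
      \<open>4 * (x \<bullet> x)\<close>.\<close>
    define y where "y = (norm x / norm (M *v x)) *\<^sub>R (M *v x)"
    have yy: "y \<bullet> y = x \<bullet> x"
      using False by (simp add: y_def power2_norm_eq_inner[symmetric] power2_eq_square)
    have "4 * (y \<bullet> (M *v x)) = (x + y) \<bullet> (M *v (x + y)) - (x - y) \<bullet> (M *v (x - y))"
      using symmetric_mat_inner[OF assms(1), of x y]
      by (simp add: matrix_vector_mult_diff_distrib matrix_vector_right_distrib algebra_simps inner_commute)
    also have "\<dots> \<le> K * ((x + y) \<bullet> (x + y)) + K * ((x - y) \<bullet> (x - y))"
      using le[of "x + y"] le[of "x - y"] by linarith
    also have "\<dots> = 4 * (K * (x \<bullet> x))"
      by (simp add: yy algebra_simps inner_commute)
    finally have "y \<bullet> (M *v x) \<le> K * (norm x * norm x)"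
      by (simp add: power2_norm_eq_inner[symmetric] power2_eq_square)
    moreover have "y \<bullet> (M *v x) = norm x * norm (M *v x)"
      using False by (simp add: y_def power2_norm_eq_inner[symmetric] power2_eq_square)
    ultimately show ?thesis
      using False by (simp add: mult.left_commute)
  qed
qed

lemma quadratic_form_le_op_norm:
  fixes M :: "real^'n^'n"
  shows "\<bar>x \<bullet> (M *v x)\<bar> \<le> op_norm M * (x \<bullet> x)"
proof -
  have "\<bar>x \<bullet> (M *v x)\<bar> \<le> norm x * norm (M *v x)"
    by (rule Cauchy_Schwarz_ineq2)
  also have "\<dots> \<le> norm x * (op_norm M * norm x)"
    by (intro mult_left_mono onorm) auto
  finally show ?thesis
    by (simp add: power2_norm_eq_inner[symmetric] power2_eq_square mult_ac)
qed

section \<open>Linear change of variables\<close>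

text \<open>The shear moves only the coordinate along \<open>a\<close>, by an amount independent of
  that coordinate. Integrating over it first reduces the claim to translation invariance on the
  line.\<close>

lemma nn_integral_lborel_shear:
  fixes a b :: "'a::euclidean_space" and g :: "'a \<Rightarrow> ennreal"
  assumes ab: "a \<in> Basis" "b \<in> Basis" "a \<noteq> b" and g [measurable]: "g \<in> borel_measurable borel"
  shows "(\<integral>\<^sup>+x. g (x + (x \<bullet> b) *\<^sub>R a) \<partial>lborel) = (\<integral>\<^sup>+x. g x \<partial>lborel)"
proof -
  interpret product_sigma_finite "\<lambda>_::'a. lborel :: real measure" ..
  let ?I = "Basis - {a}"
  let ?s = "\<lambda>f. \<Sum>c\<in>Basis. f c *\<^sub>R c :: 'a"
  let ?r = "\<lambda>f. \<Sum>c\<in>?I. f c *\<^sub>R c :: 'a"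
  have I: "insert a ?I = Basis" "finite ?I" "a \<notin> ?I"
    using ab by auto
  have fubini: "(\<integral>\<^sup>+x. h x \<partial>lborel) = (\<integral>\<^sup>+f. (\<integral>\<^sup>+t. h (?r f + t *\<^sub>R a) \<partial>lborel) \<partial>Pi\<^sub>M ?I (\<lambda>_. lborel))"
    if [measurable]: "h \<in> borel_measurable borel" for h :: "'a \<Rightarrow> ennreal"
  proof -
    have s: "?s (f(a := t)) = ?r f + t *\<^sub>R a" for f t
    proof -
      have "?s (f(a := t)) = t *\<^sub>R a + (\<Sum>c\<in>?I. (f(a := t)) c *\<^sub>R c)"
        using sum.remove[of Basis a "\<lambda>c. (f(a := t)) c *\<^sub>R c"] ab by simp
      also have "(\<Sum>c\<in>?I. (f(a := t)) c *\<^sub>R c) = ?r f"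
        by (intro sum.cong) auto
      finally show ?thesis by (simp add: add.commute)
    qed
    have "(\<integral>\<^sup>+x. h x \<partial>lborel) = (\<integral>\<^sup>+f. h (?s f) \<partial>Pi\<^sub>M (insert a ?I) (\<lambda>_. lborel))"
      by (subst lborel_eq) (simp add: nn_integral_distr insert_absorb[OF ab(1)])
    also have "\<dots> = (\<integral>\<^sup>+f. (\<integral>\<^sup>+t. h (?s (f(a := t))) \<partial>lborel) \<partial>Pi\<^sub>M ?I (\<lambda>_. lborel))"
      by (subst product_nn_integral_insert[OF I(2,3)]) (simp_all add: I(1))
    finally show ?thesis by (simp only: s)
  qed
  \<comment> \<open>Since \<open>a \<noteq> b\<close>, the shift does not involve the inner variable
    \<open>t\<close>.\<close>
  have coord: "(?r f + t *\<^sub>R a) \<bullet> b = f b" for f t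
  proof -
    have "?r f \<bullet> b = (\<Sum>c\<in>?I. if c = b then f c else 0)"
      unfolding inner_sum_left using ab by (intro sum.cong) (auto simp: inner_Basis)
    then show ?thesis
      using ab by (simp add: inner_add_left inner_Basis)
  qed
  have "(\<integral>\<^sup>+x. g (x + (x \<bullet> b) *\<^sub>R a) \<partial>lborel)
      = (\<integral>\<^sup>+f. (\<integral>\<^sup>+t. g (?r f + t *\<^sub>R a + f b *\<^sub>R a) \<partial>lborel) \<partial>Pi\<^sub>M ?I (\<lambda>_. lborel))"
    by (subst fubini) (simp_all add: coord)
  also have "\<dots> = (\<integral>\<^sup>+f. (\<integral>\<^sup>+t. g (?r f + t *\<^sub>R a) \<partial>lborel) \<partial>Pi\<^sub>M ?I (\<lambda>_. lborel))"
  proof (rule nn_integral_cong)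
    fix f
    show "(\<integral>\<^sup>+t. g (?r f + t *\<^sub>R a + f b *\<^sub>R a) \<partial>lborel) = (\<integral>\<^sup>+t. g (?r f + t *\<^sub>R a) \<partial>lborel)"
      by (subst (2) nn_integral_real_affine[where c = 1 and t = "f b"])
         (simp_all add: algebra_simps)
  qed
  also have "\<dots> = (\<integral>\<^sup>+x. g x \<partial>lborel)"
    by (rule fubini[symmetric]) simp
  finally show ?thesis .
qed

lemma linear_borel_measurable:
  fixes f :: "'a::euclidean_space \<Rightarrow> 'b::euclidean_space"
  assumes "linear f"
  shows "f \<in> borel_measurable borel"
  using assms by (intro borel_measurable_continuous_onI linear_continuous_on) (simp add: linear_linear)

text \<open>The library's linear change of variables needs a well-ordered index type;
  the decomposition into elementary maps used here does not.\<close>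

lemma nn_integral_lborel_linear:
  fixes f :: "real^'n \<Rightarrow> real^'n" and g :: "real^'n \<Rightarrow> ennreal"
  assumes "linear f" and "det (matrix f) \<noteq> 0" and "g \<in> borel_measurable borel"
  shows "(\<integral>\<^sup>+x. g x \<partial>lborel) = ennreal \<bar>det (matrix f)\<bar> * (\<integral>\<^sup>+x. g (f x) \<partial>lborel)"
proof -
  \<comment> \<open>The test function is quantified inside the predicate, so that the composition
    case can apply the second hypothesis to \<open>g\<close> composed with \<open>f\<close>.\<close>
  let ?P = "\<lambda>f::real^'n \<Rightarrow> real^'n. det (matrix f) \<noteq> 0 \<longrightarrow> (\<forall>g\<in>borel_measurable borel.
     (\<integral>\<^sup>+x. g x \<partial>lborel) = ennreal \<bar>det (matrix f)\<bar> * (\<integral>\<^sup>+x. g (f x) \<partial>lborel))"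
  have "?P f"
  proof (rule induct_linear_elementary[OF assms(1)])
    fix f h :: "real^'n \<Rightarrow> real^'n"
    assume lin: "linear f" "linear h" and Pf: "?P f" and Ph: "?P h"
    have det: "det (matrix (f \<circ> h)) = det (matrix f) * det (matrix h)"
      by (simp add: matrix_compose[OF lin(2,1)] det_mul)
    show "?P (f \<circ> h)"
    proof (intro impI ballI)
      fix g :: "real^'n \<Rightarrow> ennreal"
      assume nz: "det (matrix (f \<circ> h)) \<noteq> 0" and [measurable]: "g \<in> borel_measurable borel"
      note [measurable] = linear_borel_measurable[OF lin(1)]
      have "(\<integral>\<^sup>+x. g x \<partial>lborel) = ennreal \<bar>det (matrix f)\<bar> * (\<integral>\<^sup>+x. g (f x) \<partial>lborel)"
        by (rule Pf[rule_format]) (use nz det in auto)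
      also have "(\<integral>\<^sup>+x. g (f x) \<partial>lborel) = ennreal \<bar>det (matrix h)\<bar> * (\<integral>\<^sup>+x. g (f (h x)) \<partial>lborel)"
        by (rule Ph[rule_format]) (use nz det in auto)
      finally show "(\<integral>\<^sup>+x. g x \<partial>lborel) = ennreal \<bar>det (matrix (f \<circ> h))\<bar> * (\<integral>\<^sup>+x. g ((f \<circ> h) x) \<partial>lborel)"
        by (simp add: det abs_mult ennreal_mult mult.assoc)
    qed
  next
    fix f :: "real^'n \<Rightarrow> real^'n" and i
    assume "linear f" "\<And>x. f x $ i = 0"
    \<comment> \<open>A map into a coordinate hyperplane is singular, so the implication in
      \<open>?P\<close> holds vacuously.\<close>
    then have "\<not> inj f"
      by (metis linear_injective_imp_surjective one_neq_zero surjE vec_component)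
    then show "?P f"
      using det_nz_iff_inj[OF \<open>linear f\<close>] by blast
  next
    fix c :: "'n \<Rightarrow> real"
    let ?h = "\<lambda>x::real^'n. \<chi> i. c i * x $ i"
    have det: "det (matrix ?h) = prod c UNIV"
      by (simp add: axis_def matrix_def det_diagonal)
    \<comment> \<open>Transfers the scaling factors from indices to basis vectors: \<open>c'\<close>
      takes the value \<open>c i\<close> at \<open>axis i 1\<close>.\<close>
    define c' where "c' b = (\<Sum>i\<in>UNIV. c i * (b $ i))" for b :: "real^'n"
    have c': "c' (axis i 1) = c i" for i
      by (simp add: c'_def axis_def if_distrib cong: if_cong)
    have Basis: "Basis = (\<lambda>i. axis i 1 :: real^'n) ` UNIV"
      by (auto simp: Basis_vec_def)
    have inj: "inj (\<lambda>i. axis i 1 :: real^'n)"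
      by (auto simp: inj_on_def axis_eq_axis)
    have h: "?h x = 0 + (\<Sum>j\<in>Basis. (c' j * (x \<bullet> j)) *\<^sub>R j)" for x
    proof -
      have "(\<Sum>j\<in>Basis. (c' j * (x \<bullet> j)) *\<^sub>R j) = (\<Sum>i\<in>UNIV. (c i * x $ i) *\<^sub>R axis i 1)"
        by (simp add: Basis sum.reindex[OF inj] c' inner_axis)
      then show ?thesis
        by (simp add: vec_eq_iff axis_def if_distrib cong: if_cong)
    qed
    have prod: "(\<Prod>j\<in>Basis. \<bar>c' j\<bar>) = \<bar>prod c UNIV\<bar>"
      by (simp add: Basis prod.reindex[OF inj] c' abs_prod)
    have hm: "?h \<in> borel_measurable borel"
      by (intro linear_borel_measurable linearI) (auto simp: vec_eq_iff algebra_simps)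
    show "?P ?h"
    proof (intro impI ballI)
      fix g :: "real^'n \<Rightarrow> ennreal"
      assume nz: "det (matrix ?h) \<noteq> 0" and [measurable]: "g \<in> borel_measurable borel"
      note [measurable] = hm
      have "c' j \<noteq> 0" if "j \<in> Basis" for j
        using nz that by (auto simp: det Basis c')
      from lborel_affine_euclidean[of c' 0, OF this]
      have "lborel = density (distr lborel borel ?h) (\<lambda>_. ennreal \<bar>prod c UNIV\<bar>)"
        unfolding h[symmetric] prod by simp
      then have "(\<integral>\<^sup>+x. g x \<partial>lborel) = (\<integral>\<^sup>+x. g x \<partial>density (distr lborel borel ?h) (\<lambda>_. ennreal \<bar>prod c UNIV\<bar>))"
        by simp
      also have "\<dots> = ennreal \<bar>prod c UNIV\<bar> * (\<integral>\<^sup>+x. g (?h x) \<partial>lborel)"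
        by (simp add: nn_integral_density nn_integral_distr nn_integral_cmult)
      finally show "(\<integral>\<^sup>+x. g x \<partial>lborel) = ennreal \<bar>det (matrix ?h)\<bar> * (\<integral>\<^sup>+x. g (?h x) \<partial>lborel)"
        by (simp add: det)
    qed
  next
    fix m n :: 'n
    assume "m \<noteq> n"
    let ?t = "Transposition.transpose m n"
    let ?h = "\<lambda>x::real^'n. \<chi> i. x $ ?t i"
    have hm: "?h \<in> borel_measurable borel"
      by (intro linear_borel_measurable linearI) (auto simp: vec_eq_iff)
    have "(\<chi> i j. if ?t i = j then 1 else 0) = (\<chi> i j. if j = ?t i then 1 else (0::real))"
      by (auto intro!: Cart_lambda_cong)
    then have "matrix ?h = transpose (\<chi> i j. mat 1 $ i $ ?t j)"
      by (auto simp: matrix_eq transpose_def axis_def mat_def matrix_def)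
    then have det: "\<bar>det (matrix ?h)\<bar> = 1"
      by (simp add: det_permute_columns permutes_swap_id sign_swap_id abs_mult)
    \<comment> \<open>Lebesgue measure is determined by its values on boxes, and permuting
      coordinates only reorders the side lengths of a box.\<close>
    have eq: "lborel = distr lborel borel ?h"
    proof (rule lborel_eqI)
      fix l u :: "real^'n"
      assume le: "\<And>b. b \<in> Basis \<Longrightarrow> l \<bullet> b \<le> u \<bullet> b"
      have le': "l $ i \<le> u $ i" for i
        using le[of "axis i 1"] by (auto simp: Basis_vec_def inner_axis)
      have "?h -` box l u = box (?h l) (?h u)"
        by (auto simp: mem_box_cart) (metis transpose_involutory)+
      then have "emeasure (distr lborel borel ?h) (box l u) = emeasure lborel (box (?h l) (?h u))"
        using hm by (simp add: emeasure_distr)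
      also have "\<dots> = (\<Prod>b\<in>Basis. (?h u - ?h l) \<bullet> b)"
        using le' by (subst emeasure_lborel_box) (auto simp: Basis_vec_def inner_axis)
      also have "(\<Prod>b\<in>Basis. (?h u - ?h l) \<bullet> b) = (\<Prod>i\<in>UNIV. (u - l) $ ?t i)"
        by (simp add: Basis_vec_def UNION_singleton_eq_range prod.reindex inj_on_def axis_eq_axis inner_axis)
      also have "\<dots> = (\<Prod>i\<in>UNIV. (u - l) $ i)"
        using prod.permute[OF permutes_swap_id[of m UNIV n], of "\<lambda>i. (u - l) $ i"]
        by (simp add: o_def)
      also have "\<dots> = (\<Prod>b\<in>Basis. (u - l) \<bullet> b)"
        by (simp add: Basis_vec_def UNION_singleton_eq_range prod.reindex inj_on_def axis_eq_axis inner_axis)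
      finally show "emeasure (distr lborel borel ?h) (box l u) = (\<Prod>b\<in>Basis. (u - l) \<bullet> b)" .
    qed simp
    show "?P ?h"
    proof (intro impI ballI)
      fix g :: "real^'n \<Rightarrow> ennreal"
      assume g: "g \<in> borel_measurable borel"
      have "(\<integral>\<^sup>+x. g x \<partial>lborel) = (\<integral>\<^sup>+x. g x \<partial>distr lborel borel ?h)"
        by (rule arg_cong[OF eq])
      also have "\<dots> = (\<integral>\<^sup>+x. g (?h x) \<partial>lborel)"
        using g hm by (subst nn_integral_distr) simp_all
      finally show "(\<integral>\<^sup>+x. g x \<partial>lborel) = ennreal \<bar>det (matrix ?h)\<bar> * (\<integral>\<^sup>+x. g (?h x) \<partial>lborel)"
        by (simp add: det)
    qed
  next
    fix m n :: 'n
    assume mn: "m \<noteq> n"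
    let ?h = "\<lambda>x::real^'n. \<chi> i. if i = m then x $ m + x $ n else x $ i"
    \<comment> \<open>The matrix arises from the identity by adding row \<open>n\<close> to row
      \<open>m\<close>, which preserves the determinant. As a map it is a shear along a coordinate
      axis.\<close>
    have row_op: "matrix ?h = (\<chi> k. if k = m then row m (mat 1) + 1 *s row n (mat 1) else row k (mat 1))"
      by (auto simp: vec_eq_iff matrix_def row_def mat_def axis_def)
    have "det (matrix ?h) = det (mat 1 :: real^'n^'n)"
      unfolding row_op by (rule det_row_operation[OF mn])
    then have det: "det (matrix ?h) = 1"
      by simp
    have h: "?h x = x + (x \<bullet> axis n 1) *\<^sub>R axis m 1" for x
    proof -
      have "x \<bullet> axis n 1 = x $ n"
        by (simp add: inner_axis)
      then show ?thesis
        by (simp add: vec_eq_iff axis_def)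
    qed
    have "(\<integral>\<^sup>+x. g (?h x) \<partial>lborel) = (\<integral>\<^sup>+x. g x \<partial>lborel)" if "g \<in> borel_measurable borel" for g :: "real^'n \<Rightarrow> ennreal"
      unfolding h using that mn by (intro nn_integral_lborel_shear) (auto simp: axis_eq_axis Basis_vec_def)
    then show "?P ?h"
      by (simp add: det)
  qed
  then show ?thesis
    using assms by blast
qed

section \<open>Gaussian integrals\<close>

lemma abs_le_one_plus_square: "\<bar>t\<bar> \<le> 1 + t\<^sup>2" for t :: real
  using zero_le_power2[of "\<bar>t\<bar> - 1"] by (simp add: power2_eq_square algebra_simps abs_if split: if_splits)

text \<open>The factors are nonnegative, so Tonelli evaluates the integral in
  \<open>ennreal\<close>; the finite value then gives integrability.\<close>

lemma has_bochner_integral_lborel_prod: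
  fixes f :: "'a::euclidean_space \<Rightarrow> real \<Rightarrow> real"
  assumes f: "\<And>b. b \<in> Basis \<Longrightarrow> has_bochner_integral lborel (f b) (I b)"
    and nonneg: "\<And>b t. b \<in> Basis \<Longrightarrow> 0 \<le> f b t"
  shows "has_bochner_integral lborel (\<lambda>x. \<Prod>b\<in>Basis. f b (x \<bullet> b)) (\<Prod>b\<in>Basis. I b)"
proof (rule has_bochner_integral_nn_integral)
  have [measurable]: "f b \<in> borel_measurable borel" if "b \<in> Basis" for b
    using f[OF that] by (auto dest: borel_measurable_has_bochner_integral)
  have I: "0 \<le> I b" "(\<integral>\<^sup>+t. f b t \<partial>lborel) = ennreal (I b)" if "b \<in> Basis" for b
    using f[OF that] nonneg[OF that] Bochner_Integration.integral_nonneg[of lborel "f b"]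
    by (auto simp: has_bochner_integral_iff nn_integral_eq_integral)
  show "(\<lambda>x. \<Prod>b\<in>Basis. f b (x \<bullet> b)) \<in> borel_measurable lborel"
    by measurable
  show "AE x in lborel. 0 \<le> (\<Prod>b\<in>Basis. f b (x \<bullet> b))"
    using nonneg by (intro AE_I2 prod_nonneg) auto
  show "0 \<le> prod I Basis"
    using I by (intro prod_nonneg) auto
  have "(\<integral>\<^sup>+x. ennreal (\<Prod>b\<in>Basis. f b (x \<bullet> b)) \<partial>lborel)
      = (\<integral>\<^sup>+x. (\<Prod>b\<in>Basis. ennreal (f b (x \<bullet> b))) \<partial>lborel)"
    by (intro nn_integral_cong prod_ennreal[symmetric] nonneg) auto
  also have "\<dots> = (\<Prod>b\<in>Basis. \<integral>\<^sup>+t. ennreal (f b t) \<partial>lborel)"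
    by (rule nn_integral_lborel_prod) auto
  also have "\<dots> = (\<Prod>b\<in>Basis. ennreal (I b))"
    by (intro prod.cong) (auto simp: I)
  also have "\<dots> = ennreal (prod I Basis)"
    by (intro prod_ennreal I)
  finally show "(\<integral>\<^sup>+x. ennreal (\<Prod>b\<in>Basis. f b (x \<bullet> b)) \<partial>lborel) = ennreal (prod I Basis)" .
qed

text \<open>With \<open>g\<close> nonnegative the substitution can be made in
  \<open>nn_integral\<close>, so integrability of \<open>g\<close> is a consequence of that of its
  pullback.\<close>

lemma has_bochner_integral_lborel_linear:
  fixes f :: "real^'n \<Rightarrow> real^'n" and g :: "real^'n \<Rightarrow> real"
  assumes f: "linear f" "det (matrix f) \<noteq> 0"
    and [measurable]: "g \<in> borel_measurable borel" and nonneg: "\<And>x. 0 \<le> g x"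
    and I: "has_bochner_integral lborel (\<lambda>x. g (f x)) I"
  shows "has_bochner_integral lborel g (\<bar>det (matrix f)\<bar> * I)"
proof (rule has_bochner_integral_nn_integral)
  have I0: "0 \<le> I" "(\<integral>\<^sup>+x. g (f x) \<partial>lborel) = ennreal I"
    using I nonneg Bochner_Integration.integral_nonneg[of lborel "\<lambda>x. g (f x)"]
    by (auto simp: has_bochner_integral_iff nn_integral_eq_integral)
  show "0 \<le> \<bar>det (matrix f)\<bar> * I"
    using I0 by simp
  show "(\<integral>\<^sup>+x. ennreal (g x) \<partial>lborel) = ennreal (\<bar>det (matrix f)\<bar> * I)"
    using I0 by (subst nn_integral_lborel_linear[OF f]) (auto simp: ennreal_mult)
qed (use nonneg in auto)

lemma has_bochner_integral_gaussian_1: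
  "has_bochner_integral lborel (\<lambda>t::real. exp (- (t\<^sup>2 / 2))) (sqrt (2 * pi))"
  "has_bochner_integral lborel (\<lambda>t::real. t\<^sup>2 * exp (- (t\<^sup>2 / 2))) (sqrt (2 * pi))"
proof -
  \<comment> \<open>The factorial quotient is the even moment of order \<open>2 * k\<close> of the
    standard normal law; it equals 1 for both \<open>k = 0\<close> and \<open>k = 1\<close>.\<close>
  have "has_bochner_integral lborel (\<lambda>t::real. sqrt (2 * pi) * (std_normal_density t * t ^ (2 * k)))
      (sqrt (2 * pi) * (fact (2 * k) / (2 ^ k * fact k)))" for k
    by (intro has_bochner_integral_mult_right std_normal_moment_even)
  from this[of 0] this[of 1]
  show "has_bochner_integral lborel (\<lambda>t::real. exp (- (t\<^sup>2 / 2))) (sqrt (2 * pi))"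
    and "has_bochner_integral lborel (\<lambda>t::real. t\<^sup>2 * exp (- (t\<^sup>2 / 2))) (sqrt (2 * pi))"
    by (simp_all add: std_normal_density_def mult.commute)
qed

lemma exp_neg_inner_eq_prod:
  fixes x :: "'a::euclidean_space"
  shows "exp (- (x \<bullet> x / 2)) = (\<Prod>b\<in>Basis. exp (- ((x \<bullet> b)\<^sup>2 / 2)))"
  unfolding euclidean_inner[of x x]
  by (simp add: exp_sum[symmetric] sum_negf sum_divide_distrib power2_eq_square)

lemma has_bochner_integral_gaussian_inner:
  "has_bochner_integral lborel (\<lambda>x::'a::euclidean_space. exp (- (x \<bullet> x / 2))) (sqrt (2 * pi) ^ DIM('a))"
proof -
  have "has_bochner_integral lborel (\<lambda>x::'a. \<Prod>b\<in>Basis. exp (- ((x \<bullet> b)\<^sup>2 / 2))) (\<Prod>b\<in>(Basis::'a set). sqrt (2 * pi))"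
    by (rule has_bochner_integral_lborel_prod[of "\<lambda>_ t. exp (- (t\<^sup>2 / 2))"])
       (simp_all add: has_bochner_integral_gaussian_1)
  then show ?thesis
    by (simp add: exp_neg_inner_eq_prod)
qed

lemma has_bochner_integral_gaussian_inner_Basis:
  fixes b :: "'a::euclidean_space"
  assumes "b \<in> Basis"
  shows "has_bochner_integral lborel (\<lambda>x::'a. (b \<bullet> x)\<^sup>2 * exp (- (x \<bullet> x / 2))) (sqrt (2 * pi) ^ DIM('a))"
proof -
  \<comment> \<open>The square sits in the factor for \<open>b\<close> alone. Both kinds of factor
    integrate to \<open>sqrt (2 * pi)\<close>, so the product is the same as without the
    square.\<close>
  let ?f = "\<lambda>c t. (if c = b then t\<^sup>2 else 1) * exp (- (t\<^sup>2 / 2) :: real)"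
  have "has_bochner_integral lborel (\<lambda>x::'a. \<Prod>c\<in>Basis. ?f c (x \<bullet> c)) (\<Prod>c\<in>(Basis::'a set). sqrt (2 * pi))"
  proof (rule has_bochner_integral_lborel_prod[of ?f])
    show "has_bochner_integral lborel (?f c) (sqrt (2 * pi))" for c
      by (cases "c = b") (simp_all add: has_bochner_integral_gaussian_1)
  qed simp
  moreover have "(\<Prod>c\<in>Basis. ?f c (x \<bullet> c)) = (b \<bullet> x)\<^sup>2 * exp (- (x \<bullet> x / 2))" for x :: 'a
    using assms by (simp add: prod.distrib exp_neg_inner_eq_prod inner_commute cong: if_cong)
  ultimately show ?thesis by simp
qed

text \<open>By rotation invariance the direction \<open>v\<close> may be taken along a coordinate axis.\<close>

lemma has_bochner_integral_gaussian_inner_sq: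
  fixes v :: "real^'n"
  shows "has_bochner_integral lborel (\<lambda>x. (v \<bullet> x)\<^sup>2 * exp (- (x \<bullet> x / 2)))
    (sqrt (2 * pi) ^ CARD('n) * (v \<bullet> v))"
proof -
  obtain k :: 'n where True by simp
  let ?b = "axis k 1 :: real^'n"
  have "norm (norm v *\<^sub>R ?b) = norm v"
    by simp
  then obtain f where f: "orthogonal_transformation f" "f (norm v *\<^sub>R ?b) = v"
    using orthogonal_transformation_exists by blast
  have lin: "linear f"
    using f(1) by (rule orthogonal_transformation_linear)
  have det: "\<bar>det (matrix f)\<bar> = 1"
    using f(1) by simp
  have inner: "f x \<bullet> f y = x \<bullet> y" for x y
    using f(1) by (simp add: orthogonal_transformation_def)
  have "v \<bullet> f x = norm v * (?b \<bullet> x)" for x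
    using inner[of "norm v *\<^sub>R ?b" x] f(2) by simp
  then have "(v \<bullet> f x)\<^sup>2 * exp (- (f x \<bullet> f x / 2)) = (v \<bullet> v) * ((?b \<bullet> x)\<^sup>2 * exp (- (x \<bullet> x / 2)))" for x
    by (simp add: inner power_mult_distrib power2_norm_eq_inner)
  moreover have "has_bochner_integral lborel (\<lambda>x. (v \<bullet> v) * ((?b \<bullet> x)\<^sup>2 * exp (- (x \<bullet> x / 2))))
      ((v \<bullet> v) * sqrt (2 * pi) ^ CARD('n))"
  proof (rule has_bochner_integral_mult_right)
    have "?b \<in> Basis"
      by (auto simp: Basis_vec_def)
    from has_bochner_integral_gaussian_inner_Basis[OF this]
    show "has_bochner_integral lborel (\<lambda>x. (?b \<bullet> x)\<^sup>2 * exp (- (x \<bullet> x / 2))) (sqrt (2 * pi) ^ CARD('n))"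
      by simp
  qed
  ultimately have I: "has_bochner_integral lborel (\<lambda>x. (v \<bullet> f x)\<^sup>2 * exp (- (f x \<bullet> f x / 2)))
      ((v \<bullet> v) * sqrt (2 * pi) ^ CARD('n))"
    by simp
  show ?thesis
    using has_bochner_integral_lborel_linear[OF lin _ _ _ I] det by (auto simp: mult.commute)
qed

text \<open>The substitution \<open>x = S *v y\<close> with
  \<open>transpose S ** M ** S = mat 1\<close> reduces the mass and the second moment to the
  standard Gaussian. The first moment vanishes because its integrand is odd.\<close>

lemma has_bochner_integral_gaussian:
  fixes M :: "real^'n^'n"
  assumes "0 \<prec>\<^sub>L M"
  defines "Z \<equiv> sqrt (2 * pi) ^ CARD('n) / sqrt (det M)"
  shows "has_bochner_integral lborel (\<lambda>x. exp (- (x \<bullet> (M *v x) / 2))) Z"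
    and "has_bochner_integral lborel (\<lambda>x. (v \<bullet> x)\<^sup>2 * exp (- (x \<bullet> (M *v x) / 2)))
      (Z * (v \<bullet> (matrix_inv M *v v)))"
    and "has_bochner_integral lborel (\<lambda>x. (v \<bullet> x) * exp (- (x \<bullet> (M *v x) / 2))) 0"
proof -
  obtain S :: "real^'n^'n" where "transpose S ** M ** S = mat 1"
    using loewner_pos_congruent_mat_1[OF assms(1)] .
  note S = congruent_mat_1[OF this]
  have inv: "matrix_inv M = S ** transpose S"
    using S(2) by (rule matrix_inv_eqI)
  have lin: "linear ((*v) S)" "det (matrix ((*v) S)) = det S"
    by simp_all
  have det: "det S \<noteq> 0"
    using S(3,4) by auto
  have [measurable]: "(*v) M \<in> borel_measurable borel"
    by (rule linear_borel_measurable) simp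
  have 1: "has_bochner_integral lborel (\<lambda>x. exp (- ((S *v x) \<bullet> (M *v (S *v x)) / 2))) (sqrt (2 * pi) ^ CARD('n))"
    using has_bochner_integral_gaussian_inner[where 'a = "real^'n"] by (simp add: S(1))
  show int1: "has_bochner_integral lborel (\<lambda>x. exp (- (x \<bullet> (M *v x) / 2))) Z"
    using has_bochner_integral_lborel_linear[OF lin(1) _ _ _ 1] det S(4) by (simp add: Z_def)
  have "v \<bullet> (S *v x) = (transpose S *v v) \<bullet> x" for x
    by (metis dot_lmul_matrix transpose_transpose vector_transpose_matrix)
  moreover have "(transpose S *v v) \<bullet> (transpose S *v v) = v \<bullet> (matrix_inv M *v v)"
    by (metis calculation inv matrix_vector_mul_assoc)
  ultimately have 2: "has_bochner_integral lborel (\<lambda>x. (v \<bullet> (S *v x))\<^sup>2 * exp (- ((S *v x) \<bullet> (M *v (S *v x)) / 2)))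
      (sqrt (2 * pi) ^ CARD('n) * (v \<bullet> (matrix_inv M *v v)))"
    using has_bochner_integral_gaussian_inner_sq[of "transpose S *v v"] by (simp add: S(1))
  show int2: "has_bochner_integral lborel (\<lambda>x. (v \<bullet> x)\<^sup>2 * exp (- (x \<bullet> (M *v x) / 2)))
      (Z * (v \<bullet> (matrix_inv M *v v)))"
    using has_bochner_integral_lborel_linear[OF lin(1) _ _ _ 2] det S(4) by (simp add: Z_def)
  let ?h = "\<lambda>x. (v \<bullet> x) * exp (- (x \<bullet> (M *v x) / 2))"
  have int: "integrable lborel ?h"
  proof (rule Bochner_Integration.integrable_bound)
    show "integrable lborel (\<lambda>x. exp (- (x \<bullet> (M *v x) / 2)) + (v \<bullet> x)\<^sup>2 * exp (- (x \<bullet> (M *v x) / 2)))"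
      using int1 int2 by (intro Bochner_Integration.integrable_add) (auto simp: has_bochner_integral_iff)
    have "\<bar>v \<bullet> x\<bar> * exp (- (x \<bullet> (M *v x) / 2)) \<le> (1 + (v \<bullet> x)\<^sup>2) * exp (- (x \<bullet> (M *v x) / 2))" for x
      by (intro mult_right_mono abs_le_one_plus_square) auto
    then show "AE x in lborel. norm (?h x)
        \<le> norm (exp (- (x \<bullet> (M *v x) / 2)) + (v \<bullet> x)\<^sup>2 * exp (- (x \<bullet> (M *v x) / 2)))"
      by (auto simp: abs_mult algebra_simps)
  qed simp
  \<comment> \<open>Reflection invariance of Lebesgue measure makes the integral of the odd function
    equal to its own negative.\<close>
  have uminus: "lborel = distr lborel borel (uminus :: real^'n \<Rightarrow> _)"
    using lborel_affine[of "-1" "0 :: real^'n"] by (simp add: density_1)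
  have "integral\<^sup>L lborel ?h = integral\<^sup>L (distr lborel borel uminus) ?h"
    by (rule arg_cong[OF uminus])
  also have "\<dots> = integral\<^sup>L lborel (\<lambda>x. ?h (- x))"
    by (rule integral_distr) simp_all
  also have "\<dots> = - integral\<^sup>L lborel ?h"
    by (simp add: vec.neg)
  finally show "has_bochner_integral lborel ?h 0"
    using int by (simp add: has_bochner_integral_iff)
qed

section \<open>Covariance bounds\<close>

text \<open>On a probability space \<open>1 + t^2\<close> dominates the linear terms, polarisation
  yields the mixed products about \<open>a\<close>, and changing the centre to \<open>b\<close> adds
  only terms of lower order.\<close>

lemma integrable_of_second_moments:
  fixes M :: "(real^'n) measure"
  assumes "prob_space M" and sets: "sets M = sets borel"
    and sq: "\<And>v. integrable M (\<lambda>x. (v \<bullet> (x - a))\<^sup>2)"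
  shows "integrable M (\<lambda>x. x)" and "integrable M (\<lambda>x. (v \<bullet> (x - b)) * (w \<bullet> (x - b)))"
proof -
  interpret prob_space M by fact
  have [measurable_cong]: "sets M = sets borel" by fact
  have lin: "integrable M (\<lambda>x. v \<bullet> (x - a))" for v
  proof (rule Bochner_Integration.integrable_bound)
    show "integrable M (\<lambda>x. 1 + (v \<bullet> (x - a))\<^sup>2)"
      using sq by simp
    show "AE x in M. norm (v \<bullet> (x - a)) \<le> norm (1 + (v \<bullet> (x - a))\<^sup>2)"
      by (simp add: abs_le_one_plus_square)
  qed measurable
  have prod: "integrable M (\<lambda>x. (v \<bullet> (x - a)) * (w \<bullet> (x - a)))" for v w
  proof -
    have eq: "(v \<bullet> (x - a)) * (w \<bullet> (x - a)) = (((v + w) \<bullet> (x - a))\<^sup>2 - ((v - w) \<bullet> (x - a))\<^sup>2) / 4" for x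
      by (simp add: inner_add_left inner_diff_left power2_eq_square algebra_simps)
    show ?thesis
      unfolding eq using sq by simp
  qed
  show "integrable M (\<lambda>x. (v \<bullet> (x - b)) * (w \<bullet> (x - b)))"
  proof -
    have eq: "(v \<bullet> (x - b)) * (w \<bullet> (x - b)) = (v \<bullet> (x - a)) * (w \<bullet> (x - a))
        + (w \<bullet> (a - b)) * (v \<bullet> (x - a)) + (v \<bullet> (a - b)) * (w \<bullet> (x - a)) + (v \<bullet> (a - b)) * (w \<bullet> (a - b))" for x
      by (simp add: inner_diff_right algebra_simps)
    show ?thesis
      by (subst Bochner_Integration.integrable_cong[OF refl eq]) (use lin prod in simp)
  qed
  have "integrable M (\<lambda>x. x \<bullet> v)" for v
  proof -
    have "x \<bullet> v = v \<bullet> (x - a) + v \<bullet> a" for x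
      by (simp add: inner_diff_right inner_commute)
    then show ?thesis using lin by simp
  qed
  then have "integrable M (\<lambda>x. \<Sum>c\<in>Basis. (x \<bullet> c) *\<^sub>R c)"
    by (intro Bochner_Integration.integrable_sum integrable_scaleR_left) auto
  then show "integrable M (\<lambda>x. x)"
    by (simp add: euclidean_representation)
qed

text \<open>The last claim is the bias-variance decomposition: moving the centre from the mean to
  \<open>a\<close> adds the square of the displacement along \<open>v\<close>.\<close>

lemma covariance_mat_quadratic_form:
  fixes M :: "(real^'n) measure"
  assumes M: "prob_space M" "sets M = sets borel"
    and sq: "\<And>v. integrable M (\<lambda>x. (v \<bullet> (x - a))\<^sup>2)"
  shows "symmetric_mat (covariance_mat M)"
    and "v \<bullet> (covariance_mat M *v v) = (LINT x|M. (v \<bullet> (x - mean_vec M))\<^sup>2)"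
    and "(LINT x|M. (v \<bullet> (x - mean_vec M))\<^sup>2) \<le> (LINT x|M. (v \<bullet> (x - a))\<^sup>2)"
proof -
  interpret prob_space M by fact
  let ?m = "mean_vec M"
  note int = integrable_of_second_moments[OF M sq]
  show "symmetric_mat (covariance_mat M)"
    by (simp add: symmetric_mat_def covariance_mat_def transpose_def mult.commute)
  have coord: "integrable M (\<lambda>x. (x $ i - ?m $ i) * (x $ j - ?m $ j))" for i j
    using int(2)[of "axis i 1" ?m "axis j 1"] by (simp add: inner_axis')
  have expand: "(v \<bullet> (x - ?m))\<^sup>2
      = (\<Sum>i\<in>UNIV. \<Sum>j\<in>UNIV. v $ i * v $ j * ((x $ i - ?m $ i) * (x $ j - ?m $ j)))" for x
    by (simp add: inner_vec_def power2_eq_square sum_product mult_ac)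
  show "v \<bullet> (covariance_mat M *v v) = (LINT x|M. (v \<bullet> (x - ?m))\<^sup>2)"
    unfolding expand using coord
    by (simp add: inner_vec_def matrix_vector_mult_def covariance_mat_def sum_distrib_left mult_ac)
  have mean: "(LINT x|M. v \<bullet> (x - ?m)) = 0"
  proof -
    have "(LINT x|M. v \<bullet> (x - ?m)) = (LINT x|M. (x - ?m) \<bullet> v)"
      by (simp add: inner_commute)
    also have "\<dots> = (LINT x|M. x - ?m) \<bullet> v"
      using int(1) by (intro integral_inner_left) auto
    also have "\<dots> = 0"
      using int(1) by (simp add: mean_vec_def prob_space)
    finally show ?thesis .
  qed
  have lin: "integrable M (\<lambda>x. v \<bullet> (x - ?m))"
    using int(1) by (intro integrable_inner_right) auto
  have sq': "integrable M (\<lambda>x. (v \<bullet> (x - ?m))\<^sup>2)"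
    using int(2)[of v ?m v] by (simp add: power2_eq_square)
  \<comment> \<open>The cross term integrates to zero by \<open>mean\<close>.\<close>
  have eq: "(v \<bullet> (x - a))\<^sup>2 = (v \<bullet> (x - ?m))\<^sup>2 + 2 * (v \<bullet> (?m - a)) * (v \<bullet> (x - ?m)) + (v \<bullet> (?m - a))\<^sup>2" for x
    by (simp add: inner_diff_right power2_eq_square algebra_simps)
  have "(LINT x|M. (v \<bullet> (x - a))\<^sup>2)
      = (LINT x|M. (v \<bullet> (x - ?m))\<^sup>2 + 2 * (v \<bullet> (?m - a)) * (v \<bullet> (x - ?m)) + (v \<bullet> (?m - a))\<^sup>2)"
    by (rule Bochner_Integration.integral_cong[OF refl eq])
  also have "\<dots> = (LINT x|M. (v \<bullet> (x - ?m))\<^sup>2) + (v \<bullet> (?m - a))\<^sup>2"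
    using lin sq' mean by (simp add: prob_space)
  finally have "(LINT x|M. (v \<bullet> (x - a))\<^sup>2) = (LINT x|M. (v \<bullet> (x - ?m))\<^sup>2) + (v \<bullet> (?m - a))\<^sup>2" .
  then show "(LINT x|M. (v \<bullet> (x - ?m))\<^sup>2) \<le> (LINT x|M. (v \<bullet> (x - a))\<^sup>2)"
    by simp
qed

lemma has_bochner_integral_lborel_translate:
  fixes f :: "'a::euclidean_space \<Rightarrow> real"
  assumes "has_bochner_integral lborel f I"
  shows "has_bochner_integral lborel (\<lambda>x. f (x - a)) I"
proof -
  have [measurable]: "f \<in> borel_measurable borel"
    using assms by (auto dest: borel_measurable_has_bochner_integral)
  have "has_bochner_integral (distr lborel borel ((+) (- a))) f I"
    using assms by (simp add: lborel_distr_plus)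
  then show ?thesis
    using integrable_distr_eq[of "(+) (- a)" lborel borel f] integral_distr[of "(+) (- a)" lborel borel f]
    by (simp add: has_bochner_integral_iff)
qed

text \<open>With \<open>Z\<close> the Gaussian normalising constant, the total mass 1 of \<open>M\<close> lies between
  \<open>K * Z P\<close> and \<open>K * Z Q\<close>, and \<open>c = Z P / Z Q\<close>; hence \<open>c \<le> K * Z P\<close> and \<open>K * Z Q \<le> 1 / c\<close>.\<close>

lemma second_moments_gaussian_bounds:
  fixes M :: "(real^'n) measure" and P Q :: "real^'n^'n"
  assumes M: "prob_space M" "M = density lborel (\<lambda>x. ennreal (\<rho> x))"
    and [measurable]: "\<rho> \<in> borel_measurable borel"
    and P: "0 \<prec>\<^sub>L P" and Q: "0 \<prec>\<^sub>L Q" and "K > 0"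
    and lower: "\<And>x. K * exp (- ((x - a) \<bullet> (P *v (x - a)) / 2)) \<le> \<rho> x"
    and upper: "\<And>x. \<rho> x \<le> K * exp (- ((x - a) \<bullet> (Q *v (x - a)) / 2))"
  defines "c \<equiv> sqrt (det Q / det P)"
  shows "0 < c" and "c \<le> 1"
    and "integrable M (\<lambda>x. (v \<bullet> (x - a))\<^sup>2)"
    and "(LINT x|M. (v \<bullet> (x - a))\<^sup>2) \<le> v \<bullet> (matrix_inv Q *v v) / c"
    and "integrable M (\<lambda>x. (v \<bullet> (x - b))\<^sup>2) \<Longrightarrow>
      c * (v \<bullet> (matrix_inv P *v v)) \<le> (LINT x|M. (v \<bullet> (x - b))\<^sup>2)"
proof -
  interpret prob_space M by fact
  define g where "g N = (\<lambda>x. exp (- ((x - a) \<bullet> (N *v (x - a)) / 2)))" for N :: "real^'n^'n"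
  define Z where "Z N = sqrt (2 * pi) ^ CARD('n) / sqrt (det N)" for N :: "real^'n^'n"
  have det: "det N > 0" if "0 \<prec>\<^sub>L N" for N :: "real^'n^'n"
    using loewner_pos_congruent_mat_1[OF that] congruent_mat_1(3) by blast
  have Z: "Z N > 0" if "0 \<prec>\<^sub>L N" for N
    using det[OF that] by (simp add: Z_def)
  \<comment> \<open>With \<open>?u\<close> the preimage of \<open>v\<close> under \<open>N\<close>,
    the value is the form of \<open>N\<close> at \<open>?u\<close>.\<close>
  have inv_nonneg: "0 \<le> v \<bullet> (matrix_inv N *v v)" if "0 \<prec>\<^sub>L N" for N :: "real^'n^'n" and v
  proof -
    let ?u = "matrix_inv N *v v"
    have "v = N *v ?u"
      by (simp add: matrix_inv_mult_vec zero_loewner_less_imp_invertible[OF that])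
    then have "v \<bullet> ?u = ?u \<bullet> (N *v ?u)"
      by (simp add: inner_commute)
    then show ?thesis
      using that by (cases "?u = 0") (auto simp: zero_loewner_less_iff less_imp_le)
  qed
  have gauss: "has_bochner_integral lborel (g N) (Z N)"
      "has_bochner_integral lborel (\<lambda>x. (v \<bullet> (x - a))\<^sup>2 * g N x) (Z N * (v \<bullet> (matrix_inv N *v v)))"
      "has_bochner_integral lborel (\<lambda>x. (v \<bullet> (x - a)) * g N x) 0"
    if "0 \<prec>\<^sub>L N" for N v
    using has_bochner_integral_gaussian(1)[OF that, THEN has_bochner_integral_lborel_translate, of a]
      has_bochner_integral_gaussian(2,3)[OF that, THEN has_bochner_integral_lborel_translate, of v a]
    by (simp_all add: g_def Z_def)
  have \<rho>: "0 \<le> \<rho> x" "K * g P x \<le> \<rho> x" "\<rho> x \<le> K * g Q x" for x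
    using lower[of x] upper[of x] \<open>K > 0\<close> by (auto simp: g_def intro: order_trans[rotated])
  have LINT: "(LINT x|M. f x) = (LINT x|lborel. \<rho> x * f x)"
      "integrable M f \<longleftrightarrow> integrable lborel (\<lambda>x. \<rho> x * f x)"
    if [measurable]: "f \<in> borel_measurable borel" for f :: "real^'n \<Rightarrow> real"
    unfolding M(2) using \<rho>(1) by (simp_all add: integral_density integrable_density)
  have int\<rho>: "integrable lborel \<rho>" "(LINT x|lborel. \<rho> x) = 1"
    using LINT[of "\<lambda>_. 1"] by (simp_all add: prob_space)
  have KP: "K * Z P \<le> 1"
  proof -
    have "(LINT x|lborel. K * g P x) \<le> (LINT x|lborel. \<rho> x)"
      using gauss(1)[OF P] int\<rho> \<rho> by (intro integral_mono) (auto simp: has_bochner_integral_iff)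
    then show ?thesis
      using gauss(1)[OF P] int\<rho> by (simp add: has_bochner_integral_iff)
  qed
  have KQ: "1 \<le> K * Z Q"
  proof -
    have "(LINT x|lborel. \<rho> x) \<le> (LINT x|lborel. K * g Q x)"
      using gauss(1)[OF Q] int\<rho> \<rho> by (intro integral_mono) (auto simp: has_bochner_integral_iff)
    then show ?thesis
      using gauss(1)[OF Q] int\<rho> by (simp add: has_bochner_integral_iff)
  qed
  \<comment> \<open>The powers of \<open>2 * pi\<close> cancel, leaving the square root of the
    determinant ratio.\<close>
  have c: "c = Z P / Z Q"
    using det[OF P] det[OF Q] by (simp add: c_def Z_def real_sqrt_divide)
  show "0 < c"
    using Z P Q by (simp add: c)
  show "c \<le> 1"
  proof -
    have "K * Z P \<le> K * Z Q"
      using KP KQ by linarith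
    then show ?thesis
      using \<open>K > 0\<close> Z[OF Q] by (simp add: c)
  qed
  have cP: "c \<le> K * Z P"
    using mult_left_mono[OF KQ, of "Z P"] Z[OF P] Z[OF Q] by (simp add: c field_simps)
  have cQ: "K * Z Q \<le> 1 / c"
    using mult_left_mono[OF KP, of "Z Q"] Z[OF P] Z[OF Q] by (simp add: c field_simps)
  have intQ: "integrable lborel (\<lambda>x. K * ((v \<bullet> (x - a))\<^sup>2 * g Q x))"
    using gauss(2)[OF Q] by (simp add: has_bochner_integral_iff)
  have leQ: "\<rho> x * (v \<bullet> (x - a))\<^sup>2 \<le> K * ((v \<bullet> (x - a))\<^sup>2 * g Q x)" for x
    using mult_right_mono[OF \<rho>(3)[of x], of "(v \<bullet> (x - a))\<^sup>2"] by (simp add: mult_ac)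
  have int: "integrable lborel (\<lambda>x. \<rho> x * (v \<bullet> (x - a))\<^sup>2)"
    by (rule Bochner_Integration.integrable_bound[OF intQ])
       (use leQ \<rho>(1) \<open>K > 0\<close> in \<open>auto simp: abs_mult g_def\<close>)
  then show "integrable M (\<lambda>x. (v \<bullet> (x - a))\<^sup>2)"
    by (subst LINT) simp_all
  have "(LINT x|M. (v \<bullet> (x - a))\<^sup>2) = (LINT x|lborel. \<rho> x * (v \<bullet> (x - a))\<^sup>2)"
    by (rule LINT) simp
  also have "\<dots> \<le> (LINT x|lborel. K * ((v \<bullet> (x - a))\<^sup>2 * g Q x))"
    using int intQ leQ by (rule integral_mono)
  also have "\<dots> = K * Z Q * (v \<bullet> (matrix_inv Q *v v))"
    using gauss(2)[OF Q] by (simp add: has_bochner_integral_iff)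
  also have "\<dots> \<le> 1 / c * (v \<bullet> (matrix_inv Q *v v))"
    using cQ inv_nonneg[OF Q] by (rule mult_right_mono)
  finally show "(LINT x|M. (v \<bullet> (x - a))\<^sup>2) \<le> v \<bullet> (matrix_inv Q *v v) / c"
    by simp
  assume "integrable M (\<lambda>x. (v \<bullet> (x - b))\<^sup>2)"
  then have intb: "integrable lborel (\<lambda>x. \<rho> x * (v \<bullet> (x - b))\<^sup>2)"
    by (subst (asm) LINT) simp_all
  define t where "t = v \<bullet> (a - b)"
  have eq: "K * g P x * (v \<bullet> (x - b))\<^sup>2
      = K * ((v \<bullet> (x - a))\<^sup>2 * g P x + 2 * t * ((v \<bullet> (x - a)) * g P x) + t\<^sup>2 * g P x)" for x
    by (simp add: t_def inner_diff_right power2_eq_square algebra_simps)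
  have "has_bochner_integral lborel
      (\<lambda>x. K * ((v \<bullet> (x - a))\<^sup>2 * g P x + 2 * t * ((v \<bullet> (x - a)) * g P x) + t\<^sup>2 * g P x))
      (K * (Z P * (v \<bullet> (matrix_inv P *v v)) + 2 * t * 0 + t\<^sup>2 * Z P))"
    by (intro has_bochner_integral_mult_right has_bochner_integral_add gauss P)
  then have intP: "has_bochner_integral lborel (\<lambda>x. K * g P x * (v \<bullet> (x - b))\<^sup>2)
      (K * (Z P * (v \<bullet> (matrix_inv P *v v)) + t\<^sup>2 * Z P))"
    by (simp add: eq)
  have "c * (v \<bullet> (matrix_inv P *v v)) \<le> K * Z P * (v \<bullet> (matrix_inv P *v v))"
    using cP inv_nonneg[OF P] by (rule mult_right_mono)
  also have "\<dots> \<le> K * (Z P * (v \<bullet> (matrix_inv P *v v)) + t\<^sup>2 * Z P)"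
    using \<open>K > 0\<close> Z[OF P] by (simp add: algebra_simps)
  also have "\<dots> = (LINT x|lborel. K * g P x * (v \<bullet> (x - b))\<^sup>2)"
    using intP by (simp add: has_bochner_integral_iff)
  also have "\<dots> \<le> (LINT x|lborel. \<rho> x * (v \<bullet> (x - b))\<^sup>2)"
    using intP intb \<rho>(2) by (intro integral_mono mult_right_mono) (auto simp: has_bochner_integral_iff)
  also have "\<dots> = (LINT x|M. (v \<bullet> (x - b))\<^sup>2)"
    by (rule LINT[symmetric]) simp
  finally show "c * (v \<bullet> (matrix_inv P *v v)) \<le> (LINT x|M. (v \<bullet> (x - b))\<^sup>2)" .
qed

section \<open>Second-order comparison at the mode\<close>

text \<open>\<open>grad\<close> records the derivative only on the coordinate axes; linearity
  recovers it in every direction.\<close>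

lemma frechet_derivative_eq_grad:
  fixes f :: "real^'n \<Rightarrow> real"
  assumes "f differentiable (at x)"
  shows "(f has_derivative (\<lambda>h. grad f x \<bullet> h)) (at x)"
proof -
  have f': "(f has_derivative frechet_derivative f (at x)) (at x)"
    using assms frechet_derivative_works by blast
  then interpret linear "frechet_derivative f (at x)"
    by (rule has_derivative_linear)
  have "frechet_derivative f (at x) h = grad f x \<bullet> h" for h
  proof -
    have "h = (\<Sum>i\<in>UNIV. h $ i *\<^sub>R axis i 1)"
      by (simp add: vec_eq_iff axis_def if_distrib cong: if_cong)
    then have "frechet_derivative f (at x) h = (\<Sum>i\<in>UNIV. frechet_derivative f (at x) (h $ i *\<^sub>R axis i 1))"
      by (metis (no_types) sum)
    then show ?thesis
      by (simp add: scale grad_def inner_vec_def mult.commute)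
  qed
  then show ?thesis
    using f' by presburger
qed

text \<open>Maclaurin with Lagrange remainder for the restriction of \<open>f\<close> to the line
  through \<open>a\<close> in direction \<open>y\<close>. The position of \<open>t\<close> is left
  open because the Hessian bounds to be applied hold everywhere.\<close>

lemma Taylor_hessian:
  fixes f :: "real^'n \<Rightarrow> real"
  assumes "C2 f"
  obtains t where "f (a + y) = f a + grad f a \<bullet> y + (y \<bullet> (hessian f (a + t *\<^sub>R y) *v y)) / 2"
proof -
  let ?p = "\<lambda>t. a + t *\<^sub>R y"
  have p: "(?p has_derivative (\<lambda>h. h *\<^sub>R y)) (at t)" for t
    by (auto intro!: derivative_eq_intros)
  \<comment> \<open>The restriction to the line and its first two derivatives, in the indexed form
    that \<open>Maclaurin\<close> expects.\<close>
  define D :: "nat \<Rightarrow> real \<Rightarrow> real" where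
    "D n = (if n = 0 then (\<lambda>t. f (?p t)) else if n = 1 then (\<lambda>t. grad f (?p t) \<bullet> y)
       else (\<lambda>t. y \<bullet> (hessian f (?p t) *v y)))" for n
  have 0: "DERIV (D 0) t :> D (Suc 0) t" for t
  proof -
    have "f differentiable (at (?p t))"
      using assms by (simp add: C2_def)
    from has_derivative_compose[OF p frechet_derivative_eq_grad[OF this]]
    show ?thesis
      by (simp add: D_def has_field_derivative_def mult.commute[of _ "grad f _ \<bullet> y"])
  qed
  have 1: "DERIV (D (Suc 0)) t :> D (Suc (Suc 0)) t" for t
  proof -
    have "grad f differentiable (at (?p t))"
      using assms by (simp add: C2_def)
    then have "(grad f has_derivative (\<lambda>h. hessian f (?p t) *v h)) (at (?p t))"
      by (simp add: jacobian_works hessian_def)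
    from has_derivative_inner_left[OF has_derivative_compose[OF p this], of y]
    show ?thesis
      by (simp add: D_def has_field_derivative_def matrix_vector_mult_scaleR inner_commute[of _ y]
          mult.commute[of _ "y \<bullet> _"])
  qed
  have D: "\<forall>n t. n < 2 \<and> 0 \<le> t \<and> t \<le> 1 \<longrightarrow> DERIV (D n) t :> D (Suc n) t"
    using 0 1 by (auto simp: less_2_cases_iff)
  obtain t where "D 0 1 = (\<Sum>m<2. D m 0 / fact m * 1 ^ m) + D 2 t / fact 2 * 1 ^ 2"
    using Maclaurin[of 1 2 D "D 0", OF _ _ refl D] by auto
  then show thesis
    by (intro that[of t]) (simp add: D_def numeral_2_eq_2)
qed

text \<open>The gradient vanishes at the minimiser, so only the second-order term of the expansion
  remains, and the Hessian bounds control it.\<close>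

lemma C2_minimum_quadratic_bounds:
  fixes f :: "real^'n \<Rightarrow> real"
  assumes "C2 f" and min: "\<And>x. f a \<le> f x"
    and lower: "\<And>x y. y \<bullet> (Q *v y) \<le> y \<bullet> (hessian f x *v y)"
    and upper: "\<And>x y. y \<bullet> (hessian f x *v y) \<le> y \<bullet> (P *v y)"
  shows "f a + (x - a) \<bullet> (Q *v (x - a)) / 2 \<le> f x"
    and "f x \<le> f a + (x - a) \<bullet> (P *v (x - a)) / 2"
proof -
  have "f differentiable (at a)"
    using assms(1) by (simp add: C2_def)
  from differential_zero_maxmin[OF UNIV_I open_UNIV frechet_derivative_eq_grad[OF this]] min
  have "grad f a \<bullet> (x - a) = 0"
    by (metis (no_types))
  moreover obtain t where "f (a + (x - a)) = f a + grad f a \<bullet> (x - a)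
      + ((x - a) \<bullet> (hessian f (a + t *\<^sub>R (x - a)) *v (x - a))) / 2"
    using Taylor_hessian[OF assms(1)] .
  ultimately show "f a + (x - a) \<bullet> (Q *v (x - a)) / 2 \<le> f x"
    and "f x \<le> f a + (x - a) \<bullet> (P *v (x - a)) / 2"
    using lower[of "x - a" "a + t *\<^sub>R (x - a)"] upper[of "x - a" "a + t *\<^sub>R (x - a)"] by simp_all
qed

section \<open>Loewner bounds for the inverse covariance\<close>

text \<open>The covariance lies between \<open>c\<close> times the inverse of \<open>P\<close> and
  \<open>1 / c\<close> times the inverse of \<open>Q\<close>; inversion reverses both
  inequalities.\<close>

lemma inverse_covariance_gaussian_bounds:
  fixes M :: "(real^'n) measure" and P Q :: "real^'n^'n"
  assumes M: "prob_space M" "M = density lborel (\<lambda>x. ennreal (\<rho> x))"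
    and "\<rho> \<in> borel_measurable borel"
    and P: "0 \<prec>\<^sub>L P" and Q: "0 \<prec>\<^sub>L Q" and "K > 0"
    and lower: "\<And>x. K * exp (- ((x - a) \<bullet> (P *v (x - a)) / 2)) \<le> \<rho> x"
    and upper: "\<And>x. \<rho> x \<le> K * exp (- ((x - a) \<bullet> (Q *v (x - a)) / 2))"
  defines "c \<equiv> sqrt (det Q / det P)"
  defines "R \<equiv> matrix_inv (covariance_mat M)"
  shows "symmetric_mat R" and "c * (u \<bullet> (Q *v u)) \<le> u \<bullet> (R *v u)"
    and "u \<bullet> (R *v u) \<le> u \<bullet> (P *v u) / c"
proof -
  let ?S = "covariance_mat M"
  note bounds = second_moments_gaussian_bounds[OF M assms(3) P Q \<open>K > 0\<close> lower upper, folded c_def]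
  have sets: "sets M = sets borel"
    by (simp add: M(2))
  note cov = covariance_mat_quadratic_form[OF M(1) sets bounds(3)]
  have c: "c > 0"
    by (rule bounds(1))
  have invP: "invertible P" and invQ: "invertible Q"
    using P Q zero_loewner_less_imp_invertible by auto
  have symP: "symmetric_mat (matrix_inv P)"
  proof -
    have "x \<bullet> (matrix_inv P *v y) = (matrix_inv P *v x) \<bullet> y" for x y
      using P symmetric_mat_inner[of P "matrix_inv P *v x" "matrix_inv P *v y"]
      by (simp add: zero_loewner_less_iff matrix_inv_mult_vec[OF invP])
    then show ?thesis
      by (simp add: symmetric_mat_iff_inner)
  qed
  have invP_pos: "0 < v \<bullet> (matrix_inv P *v v)" if "v \<noteq> 0" for v
  proof -
    have "matrix_inv P *v v \<noteq> 0"
      using that by (metis invP matrix_inv_mult_vec(1) matrix_vector_mult_0_right)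
    then have "0 < (matrix_inv P *v v) \<bullet> (P *v (matrix_inv P *v v))"
      using P by (simp add: zero_loewner_less_iff)
    then show ?thesis
      by (simp add: matrix_inv_mult_vec[OF invP] inner_commute)
  qed
  have le_Q: "v \<bullet> (?S *v v) \<le> v \<bullet> (((1 / c) *\<^sub>R matrix_inv Q) *v v)" for v
    using cov(2,3)[of v] bounds(4)[of v] by (simp add: scaleR_matrix_vector_assoc[symmetric])
  have ge_P: "v \<bullet> ((c *\<^sub>R matrix_inv P) *v v) \<le> v \<bullet> (?S *v v)" for v
    using integrable_of_second_moments(2)[OF M(1) sets bounds(3), of v "mean_vec M" v]
      cov(2)[of v] bounds(5)[of v "mean_vec M"]
    by (simp add: scaleR_matrix_vector_assoc[symmetric] power2_eq_square)
  \<comment> \<open>Positivity is inherited from the lower bound \<open>ge_P\<close>; it makes the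
    covariance invertible, so that \<open>R\<close> is a genuine inverse.\<close>
  have S_pos: "0 \<prec>\<^sub>L ?S"
    unfolding zero_loewner_less_iff
  proof (intro conjI allI impI cov(1))
    fix v :: "real^'n"
    assume "v \<noteq> 0"
    then have "0 < v \<bullet> ((c *\<^sub>R matrix_inv P) *v v)"
      using invP_pos c by (simp add: scaleR_matrix_vector_assoc[symmetric])
    with ge_P[of v] show "0 < v \<bullet> (?S *v v)"
      by linarith
  qed
  note S_inv = matrix_inv_mult_vec[OF zero_loewner_less_imp_invertible[OF S_pos], folded R_def]
  show "symmetric_mat R"
    using symmetric_mat_inner[OF cov(1), of "R *v _" "R *v _"]
    by (simp add: symmetric_mat_iff_inner S_inv)
  \<comment> \<open>The two vectors compared are the preimages of the same \<open>u\<close> under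
    the upper bound and under the covariance.\<close>
  have "(c *\<^sub>R (Q *v u)) \<bullet> u \<le> (R *v u) \<bullet> u"
  proof (rule quadratic_form_inverse_antimono[OF cov(1) _ le_Q S_inv(1)])
    show "0 \<le> v \<bullet> (?S *v v)" for v
      using S_pos by (cases "v = 0") (auto simp: zero_loewner_less_iff less_imp_le)
    show "((1 / c) *\<^sub>R matrix_inv Q) *v (c *\<^sub>R (Q *v u)) = u"
      using c by (simp add: scaleR_matrix_vector_assoc[symmetric] matrix_vector_mult_scaleR
          matrix_inv_mult_vec[OF invQ])
  qed
  then show "c * (u \<bullet> (Q *v u)) \<le> u \<bullet> (R *v u)"
    by (simp add: inner_commute)
  have "(R *v u) \<bullet> u \<le> ((1 / c) *\<^sub>R (P *v u)) \<bullet> u"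
  proof (rule quadratic_form_inverse_antimono[OF _ _ ge_P _ S_inv(1)])
    show "symmetric_mat (c *\<^sub>R matrix_inv P)"
      using symP by (simp add: symmetric_mat_def transpose_scalar)
    show "0 \<le> v \<bullet> ((c *\<^sub>R matrix_inv P) *v v)" for v
      using invP_pos[of v] c
      by (cases "v = 0") (auto simp: scaleR_matrix_vector_assoc[symmetric] less_imp_le)
    show "(c *\<^sub>R matrix_inv P) *v ((1 / c) *\<^sub>R (P *v u)) = u"
      using c by (simp add: scaleR_matrix_vector_assoc[symmetric] matrix_vector_mult_scaleR
          matrix_inv_mult_vec[OF invP])
  qed
  then show "u \<bullet> (R *v u) \<le> u \<bullet> (P *v u) / c"
    by (simp add: inner_commute)
qed

section \<open>Assembly of the norm estimate\<close>

lemma mat_vector_mult: "mat k *v x = k *\<^sub>R (x :: real^'n)"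
proof -
  have "mat k = k *\<^sub>R (mat 1 :: real^'n^'n)"
    by (simp add: vec_eq_iff mat_def)
  then show ?thesis
    by (simp add: scaleR_matrix_vector_assoc[symmetric])
qed

theorem corollary10:
  fixes M :: "(real^'d) measure"
    and \<rho> U :: "real^'d \<Rightarrow> real"
    and xstar \<mu> :: "real^'d"
    and \<Sigma> A Dp Dm Pp Pm :: "real^'d^'d"
    and B :: "real^'d \<Rightarrow> real^'d^'d"
    and \<epsilon> c :: real
  assumes "prob_space M"
    and "M = density lborel (\<lambda>x. ennreal (\<rho> x))"
    and "\<exists>k>0. \<forall>x. \<rho> x = k * exp (- U x)"
    and "C2 U"
    and "\<Sigma> = covariance_mat M"
    and "\<mu> = mean_vec M"
    and "is_arg_max \<rho> (\<lambda>_. True) xstar"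
    and "symmetric_mat A"
    and "\<And>x. symmetric_mat (B x)"
    and "\<And>x. hessian U x = A + B x"
    and "\<epsilon> > 0"
    and "\<And>x. op_norm (B x) \<le> \<epsilon>"
    and "mat \<epsilon> \<prec>\<^sub>L A"
    and "1 - (xstar - \<mu>) \<bullet> ((A + mat \<epsilon>) *v (xstar - \<mu>)) > 0"
    and "c = sqrt (det (A - mat \<epsilon>) * inverse (det (A + mat \<epsilon>)))"
    and "Dp = (A + mat \<epsilon>) ** outer (xstar - \<mu>) (xstar - \<mu>)"
    and "Dm = (A - mat \<epsilon>) ** outer (xstar - \<mu>) (xstar - \<mu>)"
    and "Pp = (inverse c * inverse (1 - trace Dp)) *\<^sub>R (Dp ** (A + mat \<epsilon>))"
    and "Pm = (c * inverse (1 - trace Dm)) *\<^sub>R (Dm ** (A - mat \<epsilon>))"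
  shows "c \<le> 1 \<and>
    (\<forall>x. op_norm (hessian U x - matrix_inv \<Sigma>)
          \<le> (inverse c + 1) * \<epsilon> + (inverse c - 1) * op_norm A
            + max (op_norm Pm) (op_norm Pp))"
proof -
  define P Q R where "P = A + mat \<epsilon>" and "Q = A - mat \<epsilon>" and "R = matrix_inv \<Sigma>"
  obtain k where k: "k > 0" "\<And>x. \<rho> x = k * exp (- U x)"
    using assms(3) by blast
  note symA = assms(8) and symB = assms(9) and hess = assms(10) and eps = assms(11)
  have P_form: "u \<bullet> (P *v u) = u \<bullet> (A *v u) + \<epsilon> * (u \<bullet> u)"
    and Q_form: "u \<bullet> (Q *v u) = u \<bullet> (A *v u) - \<epsilon> * (u \<bullet> u)" for u
    by (simp_all add: P_def Q_def mat_vector_mult inner_add_right inner_diff_right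
        matrix_vector_mult_add_rdistrib matrix_vector_mult_diff_rdistrib)
  have symPQ: "symmetric_mat P" "symmetric_mat Q"
    using symA by (simp_all add: symmetric_mat_iff_inner P_def Q_def mat_vector_mult inner_add_right
        inner_diff_right inner_add_left inner_diff_left matrix_vector_mult_add_rdistrib
        matrix_vector_mult_diff_rdistrib)
  have A_gt: "\<epsilon> * (u \<bullet> u) < u \<bullet> (A *v u)" if "u \<noteq> 0" for u
    using assms(13) that by (simp add: loewner_less_def mat_vector_mult)
  have posQ: "0 \<prec>\<^sub>L Q"
    using A_gt symPQ by (simp add: zero_loewner_less_iff Q_form)
  have posP: "0 \<prec>\<^sub>L P"
  proof -
    have "0 < u \<bullet> (P *v u)" if "u \<noteq> 0" for u
      using A_gt[OF that] mult_nonneg_nonneg[OF less_imp_le[OF eps] inner_ge_zero[of u]]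
      unfolding P_form by linarith
    then show ?thesis
      using symPQ by (simp add: zero_loewner_less_iff)
  qed
  have B_le: "\<bar>u \<bullet> (B x *v u)\<bar> \<le> \<epsilon> * (u \<bullet> u)" for x u
    using quadratic_form_le_op_norm[of u "B x"] mult_right_mono[OF assms(12)[of x] inner_ge_zero[of u]]
    by linarith
  have hess_form: "u \<bullet> (hessian U x *v u) = u \<bullet> (A *v u) + u \<bullet> (B x *v u)" for x u
    by (simp add: hess matrix_vector_mult_add_rdistrib inner_add_right)
  \<comment> \<open>\<open>k * exp (- U x)\<close> is strictly decreasing in \<open>U x\<close>, so
    a maximiser of the density minimises \<open>U\<close>.\<close>
  have min: "U xstar \<le> U x" for x
    using assms(7) k by (auto simp: is_arg_max_def not_less)
  have U_bounds: "U xstar + (x - xstar) \<bullet> (Q *v (x - xstar)) / 2 \<le> U x"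
      "U x \<le> U xstar + (x - xstar) \<bullet> (P *v (x - xstar)) / 2" for x
  proof -
    have "u \<bullet> (Q *v u) \<le> u \<bullet> (hessian U x *v u)" "u \<bullet> (hessian U x *v u) \<le> u \<bullet> (P *v u)" for u x
      using B_le[of u x] by (simp_all add: hess_form P_form Q_form abs_le_iff)
    from C2_minimum_quadratic_bounds[OF assms(4) min this, of x]
    show "U xstar + (x - xstar) \<bullet> (Q *v (x - xstar)) / 2 \<le> U x"
      "U x \<le> U xstar + (x - xstar) \<bullet> (P *v (x - xstar)) / 2"
      by auto
  qed
  \<comment> \<open>The value of the density at its mode, which is the common peak of both
    comparison Gaussians.\<close>
  define K where "K = k * exp (- U xstar)"
  have K: "K > 0"
    using k by (simp add: K_def)
  have K_exp: "K * exp (- t) = k * exp (- (U xstar + t))" for t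
    by (simp add: K_def exp_add[symmetric])
  have lower: "K * exp (- ((x - xstar) \<bullet> (P *v (x - xstar)) / 2)) \<le> \<rho> x"
    and upper: "\<rho> x \<le> K * exp (- ((x - xstar) \<bullet> (Q *v (x - xstar)) / 2))" for x
    unfolding K_exp k(2) using U_bounds[of x] k(1) by (auto intro!: mult_left_mono)
  have "continuous_on UNIV U"
    using assms(4) by (auto simp: C2_def differentiable_imp_continuous_within continuous_on_eq_continuous_within)
  then have meas: "\<rho> \<in> borel_measurable borel"
    unfolding k(2)[abs_def] by (intro borel_measurable_continuous_onI continuous_intros)
  have c: "c = sqrt (det Q / det P)"
    using assms(15) by (simp add: P_def Q_def divide_inverse)
  note c_bounds = second_moments_gaussian_bounds(1,2)[OF assms(1,2) meas posP posQ K lower upper, folded c]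
  note R_bounds = inverse_covariance_gaussian_bounds[OF assms(1,2) meas posP posQ K lower upper,
      folded c assms(5) R_def]
  have op_norm_nonneg: "0 \<le> op_norm N" for N :: "real^'d^'d"
    by (intro onorm_pos_le matrix_vector_mul_bounded_linear)
  let ?K = "(inverse c + 1) * \<epsilon> + (inverse c - 1) * op_norm A"
  have "op_norm (hessian U x - R) \<le> ?K" for x
  proof (rule symmetric_mat_op_norm_le)
    show "symmetric_mat (hessian U x - R)"
      using symA symB[of x] R_bounds(1)
      by (simp add: symmetric_mat_iff_inner hess inner_add_right inner_diff_right inner_add_left
          inner_diff_left matrix_vector_mult_add_rdistrib matrix_vector_mult_diff_rdistrib)
    fix u :: "real^'d"
    define s \<alpha> r where "s = u \<bullet> u" and "\<alpha> = u \<bullet> (A *v u)" and "r = u \<bullet> (R *v u)"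
    have s: "0 \<le> \<epsilon> * s"
      using eps by (simp add: s_def)
    have \<alpha>: "0 \<le> \<alpha>" "\<alpha> \<le> op_norm A * s"
      using A_gt[of u] s quadratic_form_le_op_norm[of u A]
      by (cases "u = 0"; simp add: \<alpha>_def s_def)+
    \<comment> \<open>The second inequality is \<open>c + inverse c \<ge> 2\<close>. It lets the
      lower estimate, with coefficient \<open>1 - c\<close>, be absorbed into the upper one.\<close>
    have inv_c: "1 \<le> inverse c" "1 - c \<le> inverse c - 1"
    proof -
      show "1 \<le> inverse c"
        using c_bounds by (simp add: one_le_inverse)
      have "0 \<le> (1 - c)\<^sup>2 * inverse c"
        using c_bounds by simp
      also have "(1 - c)\<^sup>2 * inverse c = inverse c - 2 + c"
        using c_bounds by (simp add: power2_eq_square field_simps)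
      finally show "1 - c \<le> inverse c - 1" by simp
    qed
    have K_ge: "inverse c * \<epsilon> * s + \<epsilon> * s + (inverse c - 1) * \<alpha> \<le> ?K * s"
      using mult_left_mono[OF \<alpha>(2), of "inverse c - 1"] inv_c(1) by (simp add: algebra_simps)
    \<comment> \<open>How far the Hessian can exceed \<open>R\<close>: its form is at most that of
      \<open>P\<close>, while \<open>r\<close> is at least \<open>c\<close> times that of
      \<open>Q\<close>.\<close>
    have "\<alpha> + \<epsilon> * s - r \<le> (1 - c) * \<alpha> + (1 + c) * (\<epsilon> * s)"
      using R_bounds(2)[of u] by (simp add: Q_form s_def \<alpha>_def r_def algebra_simps)
    also have "\<dots> \<le> (inverse c - 1) * \<alpha> + (1 + inverse c) * (\<epsilon> * s)"
      using inv_c c_bounds \<alpha> s by (intro add_mono mult_right_mono) auto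
    also have "\<dots> \<le> ?K * s"
      using K_ge by (simp add: algebra_simps)
    finally have 1: "\<alpha> + \<epsilon> * s - r \<le> ?K * s" .
    \<comment> \<open>The opposite deviation. Inserting
      \<open>r \<le> u \<bullet> (P *v u) / c\<close> gives exactly the left side of
      \<open>K_ge\<close>, so this direction dictates the constants.\<close>
    have "r - \<alpha> + \<epsilon> * s \<le> ?K * s"
      using R_bounds(3)[of u] K_ge by (simp add: P_form s_def \<alpha>_def r_def divide_inverse algebra_simps)
    \<comment> \<open>The form of the Hessian differs from \<open>\<alpha>\<close> by at most
      \<open>\<epsilon> * s\<close>, so the two one-sided estimates bound the absolute
      value.\<close>
    with 1 show "\<bar>u \<bullet> ((hessian U x - R) *v u)\<bar> \<le> ?K * (u \<bullet> u)"
      using B_le[of u x]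
      by (simp add: matrix_vector_mult_diff_rdistrib inner_diff_right hess_form abs_le_iff s_def \<alpha>_def r_def)
  qed
  moreover have "0 \<le> max (op_norm Pm) (op_norm Pp)"
    using op_norm_nonneg by (simp add: le_max_iff_disj)
  ultimately show ?thesis
    using c_bounds(2) by (auto simp: R_def intro: add_increasing2)
qed

end
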